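(* For all integers $r \geq 2$, we have $\tilde{m}_2'(r) \geq 2^r + 1$.
   Context: Each nonnegative integer $k$ is identified with the set $\{0,\dots,k-1\}$, and functions are identified with their graphs (so $\varphi \subseteq f$ means that $f$ extends $\varphi$). $[X \rightharpoonup k]$ denotes the set of all partial maps from $X$ to $k$, i.e. functions $\varphi$ defined on a subset $\mathrm{dom}(\varphi)$ of $X$ with values in $k$. A family $\mathcal{F} \subseteq [X \rightharpoonup k]$ is $r$-uniform if $|\mathrm{dom}(\varphi)| = r$ for all $\varphi \in \mathcal{F}$, and unary if $\mathrm{dom}(\varphi) \neq \mathrm{dom}(\psi)$ for all distinct $\varphi, \psi \in \mathcal{F}$. An $\mathcal{F}$-coloring is a (total) function $f \colon X \to k$ such that $\varphi \not\subseteq f$ for all $\varphi \in \mathcal{F}$. For $r \geq 2$, $\tilde{m}_k'(r)$ denotes the smallest cardinality of a unary $r$-uniform family $\mathcal{F} \subseteq [\mathbb{N} \rightharpoonup k]$ without an $\mathcal{F}$-coloring. *)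

theory Defs imports Main begin

text \<open>A natural number \<open>k\<close> stands for the set \<open>{..<k}\<close>. Partial functions are maps
  \<open>'a \<rightharpoonup> nat\<close>, and inclusion of graphs is the library's \<open>\<subseteq>\<^sub>m\<close>.\<close>

definition partial_maps :: "'a set \<Rightarrow> nat \<Rightarrow> ('a \<rightharpoonup> nat) set" where
  "partial_maps X k = {\<phi>. dom \<phi> \<subseteq> X \<and> ran \<phi> \<subseteq> {..<k}}"

text \<open>The conjunct \<open>finite (dom \<phi>)\<close> only matters for \<open>r = 0\<close>, since \<open>card\<close> is 0 on infinite sets.\<close>

definition uniform_family :: "nat \<Rightarrow> ('a \<rightharpoonup> nat) set \<Rightarrow> bool" where
  "uniform_family r F \<longleftrightarrow> (\<forall>\<phi>\<in>F. finite (dom \<phi>) \<and> card (dom \<phi>) = r)"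

definition unary_family :: "('a \<rightharpoonup> nat) set \<Rightarrow> bool" where
  "unary_family F \<longleftrightarrow> (\<forall>\<phi>\<in>F. \<forall>\<psi>\<in>F. \<phi> \<noteq> \<psi> \<longrightarrow> dom \<phi> \<noteq> dom \<psi>)"

text \<open>A total function \<open>X \<rightarrow> k\<close> is a partial map in \<open>partial_maps X k\<close> whose domain is all of \<open>X\<close>.\<close>

definition family_coloring :: "'a set \<Rightarrow> nat \<Rightarrow> ('a \<rightharpoonup> nat) set \<Rightarrow> ('a \<rightharpoonup> nat) \<Rightarrow> bool" where
  "family_coloring X k F f \<longleftrightarrow>
     f \<in> partial_maps X k \<and> dom f = X \<and> (\<forall>\<phi>\<in>F. \<not> \<phi> \<subseteq>\<^sub>m f)"

text \<open>For \<open>r \<ge> 2\<close> finite families without a coloring exist (by a counting argument), so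
  the smallest cardinality is a natural number and is attained by a finite family. The guard
  \<open>finite F\<close> is needed because \<open>card\<close> is 0 on infinite sets.\<close>

definition m_tilde' :: "nat \<Rightarrow> nat \<Rightarrow> nat" where
  "m_tilde' k r = (LEAST n. \<exists>F. F \<subseteq> partial_maps (UNIV :: nat set) k \<and>
     uniform_family r F \<and> unary_family F \<and>
     (\<nexists>f. family_coloring UNIV k F f) \<and> finite F \<and> card F = n)"

end

theory Submission imports Defs begin

text \<open>
  The bound \<open>2 ^ r\<close> is the usual union bound: if every colouring extends some \<open>\<phi> \<in> F\<close>, then,
  since each \<open>\<phi>\<close> is extended by a fraction \<open>2 ^ - r\<close> of all colourings of a finite ground set \<open>V\<close>,
  there must be \<open>2 ^ r\<close> members. Unarity gains one more by a parity argument. Fix one member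
  \<open>\<phi>\<^sub>0\<close> with domain \<open>S\<close> and apply the union bound only to the half of the colourings whose number
  of ones on \<open>S\<close> has the parity opposite to that of \<open>\<phi>\<^sub>0\<close>. This half contains no extension of
  \<open>\<phi>\<^sub>0\<close>. Any other member \<open>\<phi>\<close> has a domain of the same size as \<open>S\<close> but different from it, so it
  leaves some \<open>s \<in> S\<close> unconstrained; flipping the colour of \<open>s\<close> shows that exactly half of the
  extensions of \<open>\<phi>\<close> have the opposite parity. Hence each other member still covers only a
  fraction \<open>2 ^ - r\<close> of that half, and there must be \<open>2 ^ r\<close> of them besides \<open>\<phi>\<^sub>0\<close>. This is
  lemma \<open>uncolorable_card_gt\<close>.

  As \<open>m_tilde'\<close> is a least element, the bound says something about it only once an uncolourable
  family is exhibited; lemma \<open>uncolorable_exists\<close> builds one by recursion on \<open>r\<close>.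
\<close>

section \<open>The lower bound by parity\<close>

lemma family_coloring_two_iff:
  "family_coloring UNIV 2 F f \<longleftrightarrow>
     (\<forall>v. f v = Some 0 \<or> f v = Some 1) \<and> (\<forall>\<phi>\<in>F. \<not> \<phi> \<subseteq>\<^sub>m f)"
proof -
  have "(ran f \<subseteq> {..<2} \<and> dom f = UNIV) \<longleftrightarrow> (\<forall>v. f v = Some 0 \<or> f v = Some 1)"
  proof (intro iffI allI)
    fix v
    assume f: "ran f \<subseteq> {..<2} \<and> dom f = UNIV"
    then obtain y where "f v = Some y" by blast
    moreover from this have "y < 2" using f ranI[of f v y] by auto
    ultimately show "f v = Some 0 \<or> f v = Some 1" by (simp add: less_2_cases_iff)
  next
    assume f: "\<forall>v. f v = Some 0 \<or> f v = Some 1"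
    have "y < 2" if "f v = Some y" for v y
      using spec[OF f, of v] that by auto
    then have "ran f \<subseteq> {..<2}" by (auto simp: ran_def)
    moreover have "v \<in> dom f" for v using spec[OF f, of v] by blast
    ultimately show "ran f \<subseteq> {..<2} \<and> dom f = UNIV" by blast
  qed
  then show ?thesis by (simp add: family_coloring_def partial_maps_def conj_assoc[symmetric])
qed

text \<open>Colourings with two colours are encoded by the set of points of colour 1, which turns
  counting colourings into counting subsets.\<close>

definition indicator_map :: "'a set \<Rightarrow> 'a \<rightharpoonup> nat" where
  "indicator_map A = (\<lambda>v. Some (of_bool (v \<in> A)))"

definition extensions :: "'a set \<Rightarrow> ('a \<rightharpoonup> nat) \<Rightarrow> 'a set set" where
  "extensions V \<phi> = {A \<in> Pow V. \<phi> \<subseteq>\<^sub>m indicator_map A}"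

lemma mem_extensions_iff:
  "A \<in> extensions V \<phi> \<longleftrightarrow> A \<subseteq> V \<and> (\<forall>v\<in>dom \<phi>. \<phi> v = Some (of_bool (v \<in> A)))"
  by (auto simp: extensions_def indicator_map_def map_le_def)

lemma finite_extensions: "finite V \<Longrightarrow> finite (extensions V \<phi>)"
  by (simp add: extensions_def)

text \<open>An extension of \<open>\<phi>\<close> is determined by its restriction to the complement of \<open>dom \<phi>\<close>.\<close>

lemma card_extensions_le:
  assumes "finite V" "dom \<phi> \<subseteq> V"
  shows "card (extensions V \<phi>) \<le> 2 ^ (card V - card (dom \<phi>))"
proof -
  have "inj_on (\<lambda>A. A - dom \<phi>) (extensions V \<phi>)"
  proof (rule inj_onI)
    fix A B
    assume A: "A \<in> extensions V \<phi>" and B: "B \<in> extensions V \<phi>" and eq: "A - dom \<phi> = B - dom \<phi>"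
    have "v \<in> A \<longleftrightarrow> v \<in> B" for v
    proof (cases "v \<in> dom \<phi>")
      case True
      then have "Some (of_bool (v \<in> A) :: nat) = Some (of_bool (v \<in> B))"
        using A B unfolding mem_extensions_iff by metis
      then show ?thesis by (simp add: of_bool_def split: if_splits)
    next
      case False
      then show ?thesis using eq by blast
    qed
    then show "A = B" by blast
  qed
  moreover have "(\<lambda>A. A - dom \<phi>) ` extensions V \<phi> \<subseteq> Pow (V - dom \<phi>)"
    by (auto simp: mem_extensions_iff)
  ultimately have "card (extensions V \<phi>) \<le> card (Pow (V - dom \<phi>))"
    using assms(1) by (intro card_inj_on_le) auto
  also have "\<dots> = 2 ^ (card V - card (dom \<phi>))"
    using assms by (simp add: card_Pow card_Diff_subset finite_subset)
  finally show ?thesis .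
qed

lemma even_card_flip:
  assumes "finite S" "s \<in> S"
  shows "even (card (sym_diff A {s} \<inter> S)) \<longleftrightarrow> odd (card (A \<inter> S))"
proof (cases "s \<in> A")
  case True
  then have "A \<inter> S = insert s (sym_diff A {s} \<inter> S)" using assms by auto
  moreover have "s \<notin> sym_diff A {s} \<inter> S" using True by auto
  moreover have "finite (sym_diff A {s} \<inter> S)" using assms by auto
  ultimately show ?thesis by (metis card_insert_disjoint even_Suc)
next
  case False
  then have "sym_diff A {s} \<inter> S = insert s (A \<inter> S)" using assms by auto
  then show ?thesis using False assms by simp
qed

text \<open>Flipping \<open>s\<close> is an involution that exchanges the two parity classes, so neither can be
  larger than the other.\<close>

lemma card_parity_class:
  assumes "finite \<A>" "finite S" "s \<in> S"
    and closed: "\<And>A. A \<in> \<A> \<Longrightarrow> sym_diff A {s} \<in> \<A>"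
  shows "2 * card {A \<in> \<A>. even (card (A \<inter> S)) = b} = card \<A>"
proof -
  let ?flip = "\<lambda>A. sym_diff A {s}"
  let ?C = "\<lambda>b. {A \<in> \<A>. even (card (A \<inter> S)) = b}"
  have flip_flip: "?flip (?flip A) = A" for A by blast
  have flip_mem: "?flip A \<in> ?C (\<not> c)" if "A \<in> ?C c" for A c
    using that closed even_card_flip[OF assms(2,3)] by auto
  have "bij_betw ?flip (?C b) (?C (\<not> b))"
    using flip_mem[of _ b] flip_mem[of _ "\<not> b"]
    by (intro bij_betw_byWitness[where f' = ?flip]) (simp_all only: flip_flip, auto)
  then have "card (?C b) = card (?C (\<not> b))" by (rule bij_betw_same_card)
  moreover have "\<A> = ?C b \<union> ?C (\<not> b)" by auto
  then have "card \<A> = card (?C b) + card (?C (\<not> b))"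
    using card_Un_disjoint[of "?C b" "?C (\<not> b)"] assms(1) by auto
  ultimately show ?thesis by simp
qed

theorem uncolorable_card_gt:
  fixes F :: "('a \<rightharpoonup> nat) set"
  assumes "r \<ge> 1" and finF: "finite F"
    and uni: "uniform_family r F" and un: "unary_family F"
    and nocol: "\<nexists>f. family_coloring UNIV 2 F f"
  shows "card F > 2 ^ r"
proof -
  define V where "V = (\<Union>\<phi>\<in>F. dom \<phi>)"
  have dom: "finite (dom \<phi>)" "card (dom \<phi>) = r" "dom \<phi> \<subseteq> V" if "\<phi> \<in> F" for \<phi>
    using that uni by (auto simp: uniform_family_def V_def)
  have finV: "finite V" using finF dom(1) by (simp add: V_def)
  have cover: "\<exists>\<phi>\<in>F. \<phi> \<subseteq>\<^sub>m indicator_map A" for A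
  proof -
    have "\<forall>v. indicator_map A v = Some 0 \<or> indicator_map A v = Some 1"
      by (simp add: indicator_map_def)
    then show ?thesis using nocol by (auto simp: family_coloring_two_iff)
  qed
  obtain \<phi>\<^sub>0 where \<phi>\<^sub>0: "\<phi>\<^sub>0 \<in> F" using cover by blast
  define S where "S = dom \<phi>\<^sub>0"
  have S: "finite S" "card S = r" "S \<subseteq> V" using dom[OF \<phi>\<^sub>0] by (auto simp: S_def)
  define b where "b = odd (card {v. \<phi>\<^sub>0 v = Some 1})"
  \<comment> \<open>The half of the colourings whose parity on \<open>S\<close> is not the parity of \<open>\<phi>\<^sub>0\<close>.\<close>
  let ?opp = "\<lambda>\<A>. {A \<in> \<A>. even (card (A \<inter> S)) = b}"
  have missed: "?opp (extensions V \<phi>\<^sub>0) = {}"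
  proof -
    have "A \<inter> S = {v. \<phi>\<^sub>0 v = Some 1}" if "A \<in> extensions V \<phi>\<^sub>0" for A
    proof -
      have "v \<in> A \<inter> S \<longleftrightarrow> \<phi>\<^sub>0 v = Some 1" for v
      proof (cases "v \<in> S")
        case True
        then have "\<phi>\<^sub>0 v = Some (of_bool (v \<in> A))"
          using that by (simp add: mem_extensions_iff S_def)
        then show ?thesis using True by simp
      next
        case False
        then show ?thesis by (auto simp: S_def)
      qed
      then show ?thesis by blast
    qed
    then show ?thesis by (auto simp: b_def)
  qed
  obtain s where s: "s \<in> S" using S assms(1) by fastforce
  have total: "2 * card (?opp (Pow V)) = 2 ^ card V"
    using card_parity_class[of "Pow V" S s b] finV S s by (auto simp: card_Pow)
  have half: "2 * card (?opp (extensions V \<phi>)) \<le> 2 ^ (card V - r)" if \<phi>: "\<phi> \<in> F - {\<phi>\<^sub>0}" for \<phi>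
  proof -
    have "dom \<phi> \<noteq> S" using \<phi> \<phi>\<^sub>0 un by (auto simp: unary_family_def S_def)
    then have "\<not> S \<subseteq> dom \<phi>"
      using \<phi> dom[of \<phi>] S card_subset_eq[of "dom \<phi>" S] by auto
    then obtain t where t: "t \<in> S" "t \<notin> dom \<phi>" by blast
    have "sym_diff A {t} \<in> extensions V \<phi>" if A: "A \<in> extensions V \<phi>" for A
    proof -
      have "v \<in> sym_diff A {t} \<longleftrightarrow> v \<in> A" if "v \<in> dom \<phi>" for v using t that by auto
      moreover have "sym_diff A {t} \<subseteq> V" using A t S by (auto simp: mem_extensions_iff)
      ultimately show ?thesis using A by (simp add: mem_extensions_iff)
    qed
    then have "2 * card (?opp (extensions V \<phi>)) = card (extensions V \<phi>)"
      using card_parity_class[OF finite_extensions[OF finV] S(1) t(1)] by blast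
    then show ?thesis using card_extensions_le[of V \<phi>] \<phi> dom[of \<phi>] finV by auto
  qed
  have "?opp (Pow V) \<subseteq> (\<Union>\<phi>\<in>F - {\<phi>\<^sub>0}. ?opp (extensions V \<phi>))"
  proof
    fix A assume A: "A \<in> ?opp (Pow V)"
    obtain \<phi> where "\<phi> \<in> F" "\<phi> \<subseteq>\<^sub>m indicator_map A" using cover by blast
    then have "A \<in> ?opp (extensions V \<phi>)" using A by (auto simp: extensions_def)
    moreover from this have "\<phi> \<noteq> \<phi>\<^sub>0" using missed by blast
    ultimately show "A \<in> (\<Union>\<phi>\<in>F - {\<phi>\<^sub>0}. ?opp (extensions V \<phi>))" using \<open>\<phi> \<in> F\<close> by blast
  qed
  then have "card (?opp (Pow V)) \<le> card (\<Union>\<phi>\<in>F - {\<phi>\<^sub>0}. ?opp (extensions V \<phi>))"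
    using finF finite_extensions[OF finV] by (intro card_mono) auto
  also have "\<dots> \<le> (\<Sum>\<phi>\<in>F - {\<phi>\<^sub>0}. card (?opp (extensions V \<phi>)))"
    using finF by (intro card_UN_le) auto
  finally have "2 ^ card V \<le> (\<Sum>\<phi>\<in>F - {\<phi>\<^sub>0}. 2 * card (?opp (extensions V \<phi>)))"
    using total by (simp flip: sum_distrib_left)
  also have "\<dots> \<le> (\<Sum>\<phi>\<in>F - {\<phi>\<^sub>0}. 2 ^ (card V - r))"
    by (rule sum_mono) (rule half)
  also have "\<dots> = card (F - {\<phi>\<^sub>0}) * 2 ^ (card V - r)" by simp
  finally have "2 ^ r * 2 ^ (card V - r) \<le> card (F - {\<phi>\<^sub>0}) * 2 ^ (card V - r)"
    using card_mono[OF finV S(3)] S(2) by (simp flip: power_add)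
  then have "2 ^ r \<le> card (F - {\<phi>\<^sub>0})" by simp
  then show ?thesis using card_Diff1_less[OF finF \<phi>\<^sub>0] by linarith
qed

section \<open>Existence of uncolourable families\<close>

text \<open>For \<open>r = 2\<close>, one member on each pair from \<open>{0, 1, 2, 3}\<close> suffices: one of 0 and 1 must
  have colour 1, one of 2 and 3 must have colour 0, and these two points together form a
  forbidden pattern.\<close>

lemma uncolorable_exists_2:
  "\<exists>F \<subseteq> partial_maps (UNIV :: nat set) 2.
     uniform_family 2 F \<and> unary_family F \<and> (\<nexists>f. family_coloring UNIV 2 F f) \<and> finite F"
proof -
  let ?F = "{[0 \<mapsto> 0, 1 \<mapsto> 0], [2 \<mapsto> 1, 3 \<mapsto> 1],
    [0 \<mapsto> 1, 2 \<mapsto> 0], [0 \<mapsto> 1, 3 \<mapsto> 0], [1 \<mapsto> 1, 2 \<mapsto> 0], [1 \<mapsto> 1, 3 \<mapsto> 0]} :: (nat \<rightharpoonup> nat) set"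
  have "?F \<subseteq> partial_maps UNIV 2"
    by (auto simp: partial_maps_def ran_def split: if_splits)
  moreover have "uniform_family 2 ?F"
    by (simp add: uniform_family_def)
  moreover have "unary_family ?F"
    by (simp add: unary_family_def doubleton_eq_iff)
  moreover have "\<not> family_coloring UNIV 2 ?F f" for f
  proof
    assume col: "family_coloring UNIV 2 ?F f"
    have val: "f v = Some 0 \<or> f v = Some 1" for v
      using col by (simp add: family_coloring_two_iff)
    have "\<not> (f 0 = Some 0 \<and> f 1 = Some 0)" "\<not> (f 2 = Some 1 \<and> f 3 = Some 1)"
      "\<not> (f 0 = Some 1 \<and> f 2 = Some 0)" "\<not> (f 0 = Some 1 \<and> f 3 = Some 0)"
      "\<not> (f 1 = Some 1 \<and> f 2 = Some 0)" "\<not> (f 1 = Some 1 \<and> f 3 = Some 0)"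
      using col by (auto simp: family_coloring_def map_le_def)
    then show False using val[of 0] val[of 1] val[of 2] val[of 3] by argo
  qed
  ultimately show ?thesis by (intro exI[of _ ?F]) auto
qed

text \<open>To increase \<open>r\<close>, a new point \<open>0\<close> selects one of two disjoint copies of the family, so that
  the colour of \<open>0\<close> decides which copy has to be coloured. The copy for colour \<open>b\<close> lives on the
  points \<open>2 * v + b + 1\<close>; since domains of members are nonempty for \<open>r \<ge> 1\<close>,
  the disjointness of the copies preserves unarity.\<close>

definition guarded_copy :: "nat \<Rightarrow> (nat \<rightharpoonup> nat) \<Rightarrow> nat \<rightharpoonup> nat" where
  "guarded_copy b \<phi> x =
     (case x of 0 \<Rightarrow> Some b | Suc y \<Rightarrow> if y mod 2 = b then \<phi> (y div 2) else None)"

lemma dom_guarded_copy: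
  assumes "b < 2"
  shows "dom (guarded_copy b \<phi>) = insert 0 ((\<lambda>v. Suc (2 * v + b)) ` dom \<phi>)"
proof -
  have "x \<in> dom (guarded_copy b \<phi>) \<longleftrightarrow> x \<in> insert 0 ((\<lambda>v. Suc (2 * v + b)) ` dom \<phi>)" for x
  proof (cases x)
    case 0
    then show ?thesis by (simp add: guarded_copy_def dom_def)
  next
    case (Suc y)
    have "y = 2 * v + b \<longleftrightarrow> y mod 2 = b \<and> v = y div 2" for v
      using assms by auto
    then have "x \<in> (\<lambda>v. Suc (2 * v + b)) ` dom \<phi> \<longleftrightarrow> y mod 2 = b \<and> y div 2 \<in> dom \<phi>"
      using Suc by (simp add: image_iff)
    then show ?thesis using Suc by (simp add: guarded_copy_def dom_def)
  qed
  then show ?thesis by blast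
qed

lemma inj_copy: "inj (\<lambda>v::nat. Suc (2 * v + b))"
  by (simp add: inj_def)

lemma dom_guarded_copy_eqD:
  assumes "b < 2" "c < 2" "dom \<phi> \<noteq> {}" "dom (guarded_copy b \<phi>) = dom (guarded_copy c \<psi>)"
  shows "b = c \<and> dom \<phi> = dom \<psi>"
proof -
  have eq: "(\<lambda>v. Suc (2 * v + b)) ` dom \<phi> = (\<lambda>v. Suc (2 * v + c)) ` dom \<psi>"
    using assms(4) unfolding dom_guarded_copy[OF assms(1)] dom_guarded_copy[OF assms(2)]
    by (subst (asm) insert_ident) auto
  obtain v where "v \<in> dom \<phi>" using assms(3) by blast
  then obtain w where "Suc (2 * v + b) = Suc (2 * w + c)" using eq by blast
  then have "b = c" using assms(1,2) by presburger
  moreover have "dom \<phi> = dom \<psi>"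
    using eq unfolding \<open>b = c\<close> by (rule inj_image_eq_iff[OF inj_copy, THEN iffD1])
  ultimately show ?thesis by simp
qed

lemma uncolorable_Suc:
  fixes F :: "(nat \<rightharpoonup> nat) set"
  assumes "r \<ge> 1" and F: "F \<subseteq> partial_maps UNIV 2" "uniform_family r F" "unary_family F" "finite F"
    and nocol: "\<nexists>f. family_coloring UNIV 2 F f"
  shows "\<exists>F \<subseteq> partial_maps (UNIV :: nat set) 2.
     uniform_family (Suc r) F \<and> unary_family F \<and> (\<nexists>f. family_coloring UNIV 2 F f) \<and> finite F"
proof -
  let ?G = "(\<lambda>(b, \<phi>). guarded_copy b \<phi>) ` ({..<2} \<times> F)"
  have "?G \<subseteq> partial_maps UNIV 2"
  proof -
    have vals: "z < 2" if "\<phi> \<in> F" "\<phi> v = Some z" for \<phi> v z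
    proof -
      have "\<phi> \<in> partial_maps UNIV 2" using F(1) that(1) by blast
      then show ?thesis using ranI[of \<phi> v z, OF that(2)] by (auto simp: partial_maps_def)
    qed
    have "y < 2" if "b < 2" "\<phi> \<in> F" "guarded_copy b \<phi> x = Some y" for b \<phi> x y
    proof (cases x)
      case 0
      then show ?thesis using that(1,3) by (simp add: guarded_copy_def)
    next
      case (Suc u)
      then show ?thesis
        using that(3) vals[OF that(2), of "u div 2" y]
        by (simp add: guarded_copy_def split: if_splits)
    qed
    then have "guarded_copy b \<phi> \<in> partial_maps UNIV 2" if "b < 2" "\<phi> \<in> F" for b \<phi>
      using that by (auto simp: partial_maps_def ran_def)
    then show ?thesis by auto
  qed
  moreover have "uniform_family (Suc r) ?G"
  proof -
    have "finite (dom (guarded_copy b \<phi>)) \<and> card (dom (guarded_copy b \<phi>)) = Suc r"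
      if "b < 2" "\<phi> \<in> F" for b \<phi>
    proof -
      let ?I = "(\<lambda>v. Suc (2 * v + b)) ` dom \<phi>"
      have \<phi>: "finite (dom \<phi>)" "card (dom \<phi>) = r"
        using that F(2) by (simp_all add: uniform_family_def)
      have "card ?I = card (dom \<phi>)"
        by (rule card_image[OF inj_on_subset[OF inj_copy subset_UNIV]])
      moreover have "0 \<notin> ?I" by blast
      moreover have "finite ?I" using \<phi>(1) by (rule finite_imageI)
      ultimately show ?thesis
        unfolding dom_guarded_copy[OF that(1)] using \<phi>(2) card_insert_disjoint[of ?I 0]
        by (metis finite_insert)
    qed
    then show ?thesis by (auto simp only: uniform_family_def lessThan_iff)
  qed
  moreover have "unary_family ?G"
    unfolding unary_family_def
  proof (intro ballI impI notI)
    fix g h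
    assume "g \<in> ?G" "h \<in> ?G" "g \<noteq> h" and dom: "dom g = dom h"
    obtain b \<phi> where g: "b < 2" "\<phi> \<in> F" "g = guarded_copy b \<phi>" using \<open>g \<in> ?G\<close> by auto
    obtain c \<psi> where h: "c < 2" "\<psi> \<in> F" "h = guarded_copy c \<psi>" using \<open>h \<in> ?G\<close> by auto
    have "card (dom \<phi>) = r" using g(2) F(2) by (simp add: uniform_family_def)
    then have "dom \<phi> \<noteq> {}" using assms(1) by force
    then have eq: "b = c \<and> dom \<phi> = dom \<psi>"
      using dom[unfolded g(3) h(3)] by (rule dom_guarded_copy_eqD[OF g(1) h(1)])
    have "\<phi> = \<psi>" using F(3) g(2) h(2) eq unfolding unary_family_def by blast
    then show False using \<open>g \<noteq> h\<close> g(3) h(3) eq by simp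
  qed
  moreover have "\<not> family_coloring UNIV 2 ?G f" for f
  proof
    assume col: "family_coloring UNIV 2 ?G f"
    then have val: "f v = Some 0 \<or> f v = Some 1" for v by (simp add: family_coloring_two_iff)
    obtain b where b: "b < 2" "f 0 = Some b"
      using val[of 0] that[of 0] that[of 1] by auto
    have "\<not> family_coloring UNIV 2 F (\<lambda>v. f (Suc (2 * v + b)))" using nocol by blast
    moreover have "\<forall>v. f (Suc (2 * v + b)) = Some 0 \<or> f (Suc (2 * v + b)) = Some 1"
      by (intro allI val)
    ultimately have "\<exists>\<phi>\<in>F. \<phi> \<subseteq>\<^sub>m (\<lambda>v. f (Suc (2 * v + b)))"
      unfolding family_coloring_two_iff by blast
    then obtain \<phi> where \<phi>: "\<phi> \<in> F" "\<phi> \<subseteq>\<^sub>m (\<lambda>v. f (Suc (2 * v + b)))" by blast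
    have "guarded_copy b \<phi> x = f x" if x: "x \<in> dom (guarded_copy b \<phi>)" for x
    proof (cases "x = 0")
      case True
      then show ?thesis using b(2) by (simp add: guarded_copy_def)
    next
      case False
      then obtain v where v: "v \<in> dom \<phi>" "x = Suc (2 * v + b)"
        using x unfolding dom_guarded_copy[OF b(1)] by blast
      have "(2 * v + b) mod 2 = b" "(2 * v + b) div 2 = v" using b(1) by simp_all
      then have "guarded_copy b \<phi> x = \<phi> v" unfolding v(2) guarded_copy_def by simp
      then show ?thesis using \<phi>(2) v unfolding map_le_def by simp
    qed
    then have "guarded_copy b \<phi> \<subseteq>\<^sub>m f" by (simp add: map_le_def)
    moreover have "guarded_copy b \<phi> \<in> ?G"
      using b(1) \<phi>(1) by (intro image_eqI[of _ _ "(b, \<phi>)"]) simp_all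
    ultimately show False using col unfolding family_coloring_def by blast
  qed
  ultimately show ?thesis using F(4) by (intro exI[of _ ?G]) simp
qed

lemma uncolorable_exists:
  assumes "r \<ge> 2"
  shows "\<exists>F \<subseteq> partial_maps (UNIV :: nat set) 2.
     uniform_family r F \<and> unary_family F \<and> (\<nexists>f. family_coloring UNIV 2 F f) \<and> finite F"
  using assms
proof (induction r rule: dec_induct)
  case base
  show ?case by (rule uncolorable_exists_2)
next
  case (step r)
  from step.IH obtain F :: "(nat \<rightharpoonup> nat) set" where
    "F \<subseteq> partial_maps UNIV 2" "uniform_family r F" "unary_family F" "finite F"
    "\<nexists>f. family_coloring UNIV 2 F f" by (elim exE conjE)
  then show ?case using step.hyps(1) by (intro uncolorable_Suc[of r F]) simp_all
qed

section \<open>The bound for the least cardinality\<close>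

theorem theorem1p23:
  fixes r :: nat
  assumes "r \<ge> 2"
  shows "m_tilde' 2 r \<ge> 2 ^ r + 1"
proof -
  let ?P = "\<lambda>n. \<exists>F. F \<subseteq> partial_maps (UNIV :: nat set) 2 \<and> uniform_family r F \<and>
    unary_family F \<and> (\<nexists>f. family_coloring UNIV 2 F f) \<and> finite F \<and> card F = n"
  have "\<exists>n. ?P n" using uncolorable_exists[OF assms] by blast
  then have "?P (m_tilde' 2 r)" unfolding m_tilde'_def by (rule LeastI_ex)
  then obtain F :: "(nat \<rightharpoonup> nat) set" where "uniform_family r F" "unary_family F"
    "\<nexists>f. family_coloring UNIV 2 F f" "finite F" "card F = m_tilde' 2 r" by blast
  then show ?thesis using uncolorable_card_gt[of r F] assms by simp
qed

end
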